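(* Let $B=(\beta_1,\beta_2,\dots,\beta_p)$ be an alternate base satisfying the weight property. Then $B$ has Property (PF).
   Context: $\mathbb{N}$ contains $0$. An alternate base with period $p\ge 1$, written $B=(\beta_1,\dots,\beta_p)$, is a purely periodic sequence $(\beta_n)_{n\ge1}$ of real numbers $\beta_n>1$ with $\beta_{n+p}=\beta_n$ for all $n$. For $k\ge1$, $B^{(k)}=(\beta_n)_{n\ge k}$ is the shifted base. For a sequence $\mathbf{x}=x_1x_2\cdots$ of integers, $\mathrm{val}\,\mathbf{x}=\sum_{n\ge1}x_n/(\beta_1\cdots\beta_n)$. Greedy expansion: for $x\in[0,1]$ put $x_1=\lfloor\beta_1x\rfloor$, $r_1=\beta_1x-x_1$, and for $n\ge2$ put $x_n=\lfloor\beta_nr_{n-1}\rfloor$, $r_n=\beta_nr_{n-1}-x_n$; the sequence $d_B(x)=x_1x_2x_3\cdots$ is the $B$-expansion of $x$ (in particular this defines $d_B(1)$). The expansion $d_{B^{(k)}}$ is defined in the same way using $B^{(k)}$. Write $\mathbf{t}^{(\ell)}=t_1^{(\ell)}t_2^{(\ell)}\cdots=d_{B^{(\ell)}}(1)$. $\mathcal{F}$ is the set of sequences $(x_n)_{n\ge1}$ of non-negative integers with only finitely many nonzero terms, and $\mathrm{Fin}(B)=\{x\in[0,1): d_B(x)\in\mathcal{F}\}$. Property (PF): for all $x,y\in\mathrm{Fin}(B)$, $x+y\in[0,1)$ implies $x+y\in\mathrm{Fin}(B)$. Notation for words: $0^k$ is a block of $k$ zeros, $0^\omega$ an infinite tail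 of zeros, juxtaposition is concatenation, $\succ_{lex}$ is the strict lexicographic order on sequences. Rewriting property: let $$\mathcal{S}=\left\{0^{p+\ell-1}t_1^{(\ell)}\cdots t_{k-1}^{(\ell)}(t_k^{(\ell)}+1)0^\omega:\ 1\le\ell\le p,\ k\ge1\right\}\cup\left\{0^{p+\ell-1}\mathbf{t}^{(\ell)}:\ 1\le\ell\le p,\ 0^{p+\ell-1}\mathbf{t}^{(\ell)}\in\mathcal{F}\right\}.$$ $B$ has the rewriting property if for every $\mathbf{a}\in\mathcal{S}$ there is a string $T(\mathbf{a})$ such that $T(\mathbf{a})\in\mathcal{F}$, $\mathrm{val}\,T(\mathbf{a})=\mathrm{val}\,\mathbf{a}$ and $T(\mathbf{a})\succ_{lex}\mathbf{a}$. Weight property: $B$ has the weight property if it has the rewriting property (with some choice of rewritings $T(\mathbf{a})$, $\mathbf{a}\in\mathcal{S}$) and, moreover, there exist positive integers $w_n$, $n\ge1$, such that the weight function $g:\mathcal{F}\to\mathbb{N}$, $g(\mathbf{a})=\sum_{n\ge1}w_na_n$, satisfies (1) $g(0^p\mathbf{a})=g(\mathbf{a})$ for every $\mathbf{a}\in\mathcal{F}$, and (2) $g(\mathbf{a})\ge g(T(\mathbf{a}))$ for every $\mathbf{a}\in\mathcal{S}$. *)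

theory Defs
  imports "HOL-Analysis.Analysis" "HOL-Library.Fun_Lexorder"
begin

text \<open>
  All sequences are indexed from 0: position \<open>n\<close> holds what is usually called the term of
  index \<open>n + 1\<close>.  A base is therefore a function \<open>\<beta>\<close> with \<open>\<beta> 0 = \<beta>\<^sub>1\<close>, the shifted base
  \<open>B\<close> with superscript \<open>(l + 1)\<close> is \<open>shift_base l \<beta>\<close>, and the shift index and the position \<open>k\<close>
  in the rewritten strings below run from 0.  Strings are sequences of integers.
\<close>

definition alternate_base :: "nat \<Rightarrow> (nat \<Rightarrow> real) \<Rightarrow> bool" where
  "alternate_base p \<beta> \<longleftrightarrow> p \<ge> 1 \<and> (\<forall>n. \<beta> n > 1) \<and> (\<forall>n. \<beta> (n + p) = \<beta> n)"

definition shift_base :: "nat \<Rightarrow> (nat \<Rightarrow> real) \<Rightarrow> (nat \<Rightarrow> real)" where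
  "shift_base l \<beta> = (\<lambda>n. \<beta> (n + l))"

definition val :: "(nat \<Rightarrow> real) \<Rightarrow> (nat \<Rightarrow> int) \<Rightarrow> real" where
  "val \<beta> x = (\<Sum>n. of_int (x n) / (\<Prod>i\<le>n. \<beta> i))"

text \<open>\<open>remainder \<beta> x n\<close> is \<open>r\<^sub>n\<close> in the greedy algorithm, with the convention \<open>r\<^sub>0 = x\<close>.\<close>

primrec remainder :: "(nat \<Rightarrow> real) \<Rightarrow> real \<Rightarrow> nat \<Rightarrow> real" where
  "remainder \<beta> x 0 = x"
| "remainder \<beta> x (Suc n) = \<beta> n * remainder \<beta> x n - of_int \<lfloor>\<beta> n * remainder \<beta> x n\<rfloor>"

definition expansion :: "(nat \<Rightarrow> real) \<Rightarrow> real \<Rightarrow> (nat \<Rightarrow> int)" where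
  "expansion \<beta> x = (\<lambda>n. \<lfloor>\<beta> n * remainder \<beta> x n\<rfloor>)"

definition finite_strings :: "(nat \<Rightarrow> int) set" where
  "finite_strings = {x. (\<forall>n. x n \<ge> 0) \<and> finite {n. x n \<noteq> 0}}"

definition Fin :: "(nat \<Rightarrow> real) \<Rightarrow> real set" where
  "Fin \<beta> = {x \<in> {0..<1}. expansion \<beta> x \<in> finite_strings}"

definition property_PF :: "(nat \<Rightarrow> real) \<Rightarrow> bool" where
  "property_PF \<beta> \<longleftrightarrow> (\<forall>x\<in>Fin \<beta>. \<forall>y\<in>Fin \<beta>. x + y \<in> {0..<1} \<longrightarrow> x + y \<in> Fin \<beta>)"

definition prepend_zeros :: "nat \<Rightarrow> (nat \<Rightarrow> int) \<Rightarrow> (nat \<Rightarrow> int)" where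
  "prepend_zeros m a = (\<lambda>n. if n < m then 0 else a (n - m))"

text \<open>The string obtained from \<open>t\<close> by adding 1 at position \<open>k\<close> and erasing all later digits.\<close>

definition truncate_incr :: "nat \<Rightarrow> (nat \<Rightarrow> int) \<Rightarrow> (nat \<Rightarrow> int)" where
  "truncate_incr k t = (\<lambda>n. if n < k then t n else if n = k then t k + 1 else 0)"

definition expansion_one :: "(nat \<Rightarrow> real) \<Rightarrow> nat \<Rightarrow> (nat \<Rightarrow> int)" where
  "expansion_one \<beta> l = expansion (shift_base l \<beta>) 1"

text \<open>Since \<open>l\<close> runs from 0 here, the number of leading zeros is \<open>p + l\<close>, not \<open>p + l - 1\<close>.\<close>

definition forbidden_strings :: "nat \<Rightarrow> (nat \<Rightarrow> real) \<Rightarrow> (nat \<Rightarrow> int) set" where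
  "forbidden_strings p \<beta> =
     {prepend_zeros (p + l) (truncate_incr k (expansion_one \<beta> l)) | l k. l < p} \<union>
     {prepend_zeros (p + l) (expansion_one \<beta> l) | l.
        l < p \<and> prepend_zeros (p + l) (expansion_one \<beta> l) \<in> finite_strings}"

text \<open>In \<open>less_fun a b\<close> the second argument is the lexicographically greater one.\<close>

definition is_rewriting ::
    "nat \<Rightarrow> (nat \<Rightarrow> real) \<Rightarrow> ((nat \<Rightarrow> int) \<Rightarrow> (nat \<Rightarrow> int)) \<Rightarrow> bool" where
  "is_rewriting p \<beta> T \<longleftrightarrow>
     (\<forall>a\<in>forbidden_strings p \<beta>.
        T a \<in> finite_strings \<and> val \<beta> (T a) = val \<beta> a \<and> less_fun a (T a))"

definition weight :: "(nat \<Rightarrow> nat) \<Rightarrow> (nat \<Rightarrow> int) \<Rightarrow> nat" where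
  "weight w a = (\<Sum>n | a n \<noteq> 0. w n * nat (a n))"

definition weight_property :: "nat \<Rightarrow> (nat \<Rightarrow> real) \<Rightarrow> bool" where
  "weight_property p \<beta> \<longleftrightarrow>
     (\<exists>T w. is_rewriting p \<beta> T \<and>
        (\<forall>n. w n > 0) \<and>
        (\<forall>a\<in>finite_strings. weight w (prepend_zeros p a) = weight w a) \<and>
        (\<forall>a\<in>forbidden_strings p \<beta>. weight w a \<ge> weight w (T a)))"

end

theory Submission
  imports Defs
begin

text \<open>
  The digitwise sum of the expansions of \<open>x\<close> and \<open>y\<close> is a finite string of value \<open>x + y\<close>, so it
  suffices that every finite string \<open>a\<close> with \<open>val \<beta> a < 1\<close> has a value in \<open>Fin \<beta>\<close>
  (\<open>val_finite_string_in_Fin\<close>).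
  
  Among all finite strings with the same value as \<open>a\<close> and at most its weight, choose a
  lexicographically maximal one.  Such a string exists because there are only finitely many
  candidates (\<open>finite_val_bounded_weight\<close>): the weights are positive, so bounded weight bounds the
  digit sum, and a string of positive value and bounded digit sum cannot start too late.
  
  The maximal string \<open>b\<close> is the greedy expansion of its value.  A finite string is greedy as soon
  as all its tails, evaluated in the correspondingly shifted bases, have value below 1
  (\<open>expansion_val\<close>).  If some tail of \<open>b\<close> had value at least 1, consider the last such tail.
  Comparing it with the expansion of 1 shows that it equals this expansion or dominates digitwise
  the expansion truncated and increased by 1 (\<open>tail_contains_forbidden\<close>).  Hence \<open>b\<close>, after
  prepending a period of zeros, dominates a shifted forbidden string.  Replacing that string by its
  rewriting keeps the value, does not increase the weight and increases the string
  lexicographically (\<open>rewrite_forbidden\<close>).  The prepended zeros are still there afterwards, since a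
  nonzero digit in the first period would make the value too large
  (\<open>leading_zeros_of_small_val\<close>), so they can be removed again.  This contradicts the choice of
  \<open>b\<close>.
\<close>

section \<open>Finite strings\<close>

lemma finite_string_bound:
  assumes "a \<in> finite_strings"
  obtains N where "\<And>m. m \<ge> N \<Longrightarrow> a m = 0"
proof -
  have "finite {n. a n \<noteq> 0}" using assms by (simp add: finite_strings_def)
  then obtain N where "\<forall>n\<in>{n. a n \<noteq> 0}. n < N"
    by (meson finite_nat_set_iff_bounded)
  then have "\<And>m. m \<ge> N \<Longrightarrow> a m = 0" by (metis linorder_not_le mem_Collect_eq)
  then show ?thesis using that by blast
qed

lemma finite_stringI:
  assumes "\<And>m. a m \<ge> 0" and "\<And>m. m \<ge> N \<Longrightarrow> a m = 0"
  shows "a \<in> finite_strings"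
proof -
  have "{n. a n \<noteq> 0} \<subseteq> {..<N}" using assms(2) by (auto simp: not_le[symmetric])
  then show ?thesis using assms(1) by (auto simp: finite_strings_def intro: finite_subset)
qed

lemma finite_strings_nonneg: "a \<in> finite_strings \<Longrightarrow> a n \<ge> 0"
  by (simp add: finite_strings_def)

lemma finite_strings_smaller:
  assumes "a \<in> finite_strings" and "\<And>n. 0 \<le> b n" and "\<And>n. b n \<le> a n"
  shows "b \<in> finite_strings"
proof -
  obtain N where "\<And>m. m \<ge> N \<Longrightarrow> a m = 0" using assms(1) by (rule finite_string_bound) blast
  then show ?thesis using assms by (intro finite_stringI[of b N]) (metis order_antisym)+
qed

lemma finite_strings_add:
  assumes "a \<in> finite_strings" and "b \<in> finite_strings"
  shows "(\<lambda>n. a n + b n) \<in> finite_strings"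
proof -
  obtain M where "\<And>m. m \<ge> M \<Longrightarrow> a m = 0" using assms(1) by (rule finite_string_bound) blast
  moreover obtain N where "\<And>m. m \<ge> N \<Longrightarrow> b m = 0"
    using assms(2) by (rule finite_string_bound) blast
  ultimately show ?thesis using assms
    by (intro finite_stringI[of _ "max M N"]) (auto simp: finite_strings_nonneg)
qed

lemma finite_strings_prepend:
  assumes "a \<in> finite_strings"
  shows "prepend_zeros m a \<in> finite_strings"
proof -
  obtain N where "\<And>i. i \<ge> N \<Longrightarrow> a i = 0" using assms by (rule finite_string_bound) blast
  then show ?thesis using assms
    by (intro finite_stringI[of _ "N + m"]) (auto simp: prepend_zeros_def finite_strings_nonneg)
qed

definition drop_digits :: "nat \<Rightarrow> (nat \<Rightarrow> int) \<Rightarrow> (nat \<Rightarrow> int)" where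
  "drop_digits m a = (\<lambda>n. a (n + m))"

lemma finite_strings_drop:
  assumes "a \<in> finite_strings"
  shows "drop_digits m a \<in> finite_strings"
proof -
  obtain N where "\<And>i. i \<ge> N \<Longrightarrow> a i = 0" using assms by (rule finite_string_bound) blast
  then show ?thesis using assms
    by (intro finite_stringI[of _ N]) (auto simp: drop_digits_def finite_strings_nonneg)
qed

lemma prepend_zeros_add: "prepend_zeros m (prepend_zeros n a) = prepend_zeros (m + n) a"
  by (auto simp: prepend_zeros_def fun_eq_iff)

section \<open>Values of finite strings\<close>

lemma val_eq_sum:
  assumes "\<And>m. m \<ge> N \<Longrightarrow> a m = 0"
  shows "val \<beta> a = (\<Sum>n<N. of_int (a n) / (\<Prod>i\<le>n. \<beta> i))"
  unfolding val_def by (rule suminf_finite) (auto simp: assms)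

lemma val_add:
  assumes "a \<in> finite_strings" and "b \<in> finite_strings"
  shows "val \<beta> (\<lambda>n. a n + b n) = val \<beta> a + val \<beta> b"
proof -
  obtain M where M: "\<And>m. m \<ge> M \<Longrightarrow> a m = 0" using assms(1) by (rule finite_string_bound) blast
  obtain N where N: "\<And>m. m \<ge> N \<Longrightarrow> b m = 0" using assms(2) by (rule finite_string_bound) blast
  show ?thesis
    using val_eq_sum[of "max M N" a \<beta>] val_eq_sum[of "max M N" b \<beta>]
      val_eq_sum[of "max M N" "\<lambda>n. a n + b n" \<beta>] M N
    by (simp add: sum.distrib[symmetric] add_divide_distrib)
qed

text \<open>
  One step of Horner's scheme.  It is the identity by which the greedy algorithm passes from a
  remainder to the next one, which is why values of tails can be compared with remainders.
\<close>

lemma val_head: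
  assumes "a \<in> finite_strings" and "\<beta> 0 > 0"
  shows "\<beta> 0 * val \<beta> a = of_int (a 0) + val (shift_base 1 \<beta>) (drop_digits 1 a)"
proof -
  obtain N where N: "\<And>m. m \<ge> N \<Longrightarrow> a m = 0" using assms(1) by (rule finite_string_bound) blast
  have "val \<beta> a = (\<Sum>n<Suc N. of_int (a n) / (\<Prod>i\<le>n. \<beta> i))"
    by (rule val_eq_sum) (simp add: N)
  also have "\<dots> = of_int (a 0) / \<beta> 0
      + (\<Sum>n<N. of_int (a (Suc n)) / (\<beta> 0 * (\<Prod>i\<le>n. \<beta> (Suc i))))"
    by (simp add: sum.lessThan_Suc_shift prod.atMost_Suc_shift del: sum.lessThan_Suc prod.atMost_Suc)
  also have "\<beta> 0 * \<dots> = of_int (a 0) + (\<Sum>n<N. of_int (a (Suc n)) / (\<Prod>i\<le>n. \<beta> (Suc i)))"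
    using assms(2) by (simp add: distrib_left sum_distrib_left)
  also have "(\<Sum>n<N. of_int (a (Suc n)) / (\<Prod>i\<le>n. \<beta> (Suc i)))
      = val (shift_base 1 \<beta>) (drop_digits 1 a)"
    using val_eq_sum[of N "drop_digits 1 a" "shift_base 1 \<beta>"] N
    by (simp add: drop_digits_def shift_base_def)
  finally show ?thesis .
qed

lemma val_drop_digits_step:
  assumes "a \<in> finite_strings" and "\<beta> n > 0"
  shows "val (shift_base (Suc n) \<beta>) (drop_digits (Suc n) a)
    = \<beta> n * val (shift_base n \<beta>) (drop_digits n a) - of_int (a n)"
  using val_head[OF finite_strings_drop[OF assms(1), of n], of "shift_base n \<beta>"] assms(2)
  by (simp add: shift_base_def drop_digits_def)

lemma val_prepend_zeros:
  assumes "a \<in> finite_strings" and "\<And>n. \<beta> n > 0"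
  shows "(\<Prod>i<m. \<beta> i) * val \<beta> (prepend_zeros m a) = val (shift_base m \<beta>) a"
  using assms(2)
proof (induction m arbitrary: \<beta>)
  case 0
  then show ?case by (simp add: prepend_zeros_def shift_base_def)
next
  case (Suc m)
  have drop: "drop_digits 1 (prepend_zeros (Suc m) a) = prepend_zeros m a"
    by (auto simp: drop_digits_def prepend_zeros_def)
  have "\<beta> 0 * val \<beta> (prepend_zeros (Suc m) a) = val (shift_base 1 \<beta>) (prepend_zeros m a)"
    using val_head[OF finite_strings_prepend[OF assms(1), of "Suc m"], of \<beta>] Suc.prems
    unfolding drop by (simp add: prepend_zeros_def)
  moreover have "(\<Prod>i<m. shift_base 1 \<beta> i) * val (shift_base 1 \<beta>) (prepend_zeros m a)
      = val (shift_base m (shift_base 1 \<beta>)) a"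
    using Suc.prems by (intro Suc.IH) (simp add: shift_base_def)
  moreover have "(\<Prod>i<Suc m. \<beta> i) = (\<Prod>i<m. shift_base 1 \<beta> i) * \<beta> 0"
    by (simp add: prod.lessThan_Suc_shift shift_base_def del: prod.lessThan_Suc)
  moreover have "shift_base m (shift_base 1 \<beta>) = shift_base (Suc m) \<beta>"
    by (simp add: shift_base_def)
  ultimately show ?case by (simp only: mult.assoc)
qed

lemma val_ge_digit:
  assumes "a \<in> finite_strings" and "\<And>n. \<beta> n > 0"
  shows "of_int (a n) / (\<Prod>i\<le>n. \<beta> i) \<le> val \<beta> a"
proof -
  obtain N where N: "\<And>m. m \<ge> N \<Longrightarrow> a m = 0" using assms(1) by (rule finite_string_bound) blast
  have "val \<beta> a = (\<Sum>m<N + Suc n. of_int (a m) / (\<Prod>i\<le>m. \<beta> i))"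
    by (rule val_eq_sum) (simp add: N)
  also have "\<dots> \<ge> of_int (a n) / (\<Prod>i\<le>n. \<beta> i)"
    using assms finite_strings_nonneg[OF assms(1)]
    by (intro member_le_sum) (auto intro!: divide_nonneg_pos prod_pos)
  finally show ?thesis .
qed

lemma val_nonneg:
  assumes "a \<in> finite_strings" and "\<And>n. \<beta> n > 0"
  shows "val \<beta> a \<ge> 0"
proof -
  have "0 \<le> of_int (a 0) / (\<Prod>i\<le>0. \<beta> i)"
    using assms finite_strings_nonneg[OF assms(1)] by (auto intro!: divide_nonneg_pos)
  then show ?thesis using val_ge_digit[where \<beta> = \<beta> and n = 0, OF assms] by linarith
qed

section \<open>Weights\<close>

lemma weight_eq_sum:
  assumes "\<And>m. m \<ge> N \<Longrightarrow> a m = 0"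
  shows "weight w a = (\<Sum>n<N. w n * nat (a n))"
  unfolding weight_def
  by (rule sum.mono_neutral_left) (auto simp: assms not_le[symmetric])

lemma weight_add:
  assumes "a \<in> finite_strings" and "b \<in> finite_strings"
  shows "weight w (\<lambda>n. a n + b n) = weight w a + weight w b"
proof -
  obtain M where M: "\<And>m. m \<ge> M \<Longrightarrow> a m = 0" using assms(1) by (rule finite_string_bound) blast
  obtain N where N: "\<And>m. m \<ge> N \<Longrightarrow> b m = 0" using assms(2) by (rule finite_string_bound) blast
  show ?thesis
    using weight_eq_sum[of "max M N" a w] weight_eq_sum[of "max M N" b w]
      weight_eq_sum[of "max M N" "\<lambda>n. a n + b n" w] M N assms
    by (simp add: sum.distrib[symmetric] nat_add_distrib distrib_left finite_strings_nonneg)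
qed

text \<open>
  Because the weights are positive integers, the weight is at least the digit sum; and no digit
  counts for more than it would at position \<open>n\<close>.  This is what prevents a string of bounded weight
  and fixed positive value from starting too far to the right.
\<close>

lemma val_le_weight:
  assumes "a \<in> finite_strings" and "\<And>n. \<beta> n > 1" and "\<And>n. w n > 0"
    and "\<And>m. m < n \<Longrightarrow> a m = 0"
  shows "val \<beta> a \<le> real (weight w a) / (\<Prod>i\<le>n. \<beta> i)"
proof -
  obtain N where N: "\<And>m. m \<ge> N \<Longrightarrow> a m = 0" using assms(1) by (rule finite_string_bound) blast
  have pos: "(\<Prod>i\<le>m. \<beta> i) > 0" for m
    by (rule prod_pos) (metis assms(2) less_trans zero_less_one)
  have "val \<beta> a = (\<Sum>m<N. of_int (a m) / (\<Prod>i\<le>m. \<beta> i))"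
    by (rule val_eq_sum) (rule N)
  also have "\<dots> \<le> (\<Sum>m<N. real (w m * nat (a m)) / (\<Prod>i\<le>n. \<beta> i))"
  proof (rule sum_mono)
    fix m
    show "of_int (a m) / (\<Prod>i\<le>m. \<beta> i) \<le> real (w m * nat (a m)) / (\<Prod>i\<le>n. \<beta> i)"
    proof (cases "m < n")
      case True
      then show ?thesis by (simp add: assms(4))
    next
      case False
      then have "(\<Prod>i\<le>n. \<beta> i) \<le> (\<Prod>i\<le>m. \<beta> i)"
        by (intro prod_mono2) (auto intro: less_imp_le assms(2) less_trans[OF zero_less_one])
      moreover have "of_int (a m) \<le> real (w m * nat (a m))"
      proof -
        have "nat (a m) \<le> w m * nat (a m)" using assms(3)[of m] by (cases "w m") auto
        then have "real (nat (a m)) \<le> real (w m * nat (a m))" by (simp only: of_nat_le_iff)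
        then show ?thesis using finite_strings_nonneg[OF assms(1), of m] by simp
      qed
      ultimately show ?thesis using pos finite_strings_nonneg[OF assms(1), of m]
        by (intro frac_le) auto
    qed
  qed
  also have "\<dots> = real (weight w a) / (\<Prod>i\<le>n. \<beta> i)"
    by (simp add: weight_eq_sum[of N a w, OF N] sum_divide_distrib)
  finally show ?thesis .
qed

section \<open>Finiteness of the strings with given value and bounded weight\<close>

definition unit_string :: "nat \<Rightarrow> (nat \<Rightarrow> int)" where
  "unit_string n = (\<lambda>m. if m = n then 1 else 0)"

lemma unit_string_finite: "unit_string n \<in> finite_strings"
  by (rule finite_stringI[of _ "Suc n"]) (auto simp: unit_string_def)

lemma weight_unit_string: "weight w (unit_string n) = w n"
  by (simp add: weight_def unit_string_def)

text \<open>
  Induction on the weight bound.  The first nonzero digit of a nonzero string in the set stands at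
  one of finitely many positions \<open>n\<close>; lowering that digit by 1 gives a string of smaller weight
  whose value is smaller by an amount depending only on \<open>n\<close>.  The value \<open>v\<close> is therefore
  arbitrary in the induction.
\<close>

lemma finite_val_bounded_weight:
  assumes "\<And>n. \<beta> n > 1" and "\<And>n. w n > 0"
    and unbounded: "\<And>C. \<exists>N. \<forall>n\<ge>N. C < (\<Prod>i\<le>n. \<beta> i)"
  shows "finite {a \<in> finite_strings. val \<beta> a = v \<and> weight w a \<le> G}"
proof (induction G arbitrary: v)
  case 0
  have "a = (\<lambda>_. 0)" if "a \<in> finite_strings" "weight w a \<le> 0" for a
  proof (rule ccontr)
    assume "a \<noteq> (\<lambda>_. 0)"
    then obtain n where "a n \<noteq> 0" by auto
    then have "w n * nat (a n) > 0"
      using assms(2)[of n] finite_strings_nonneg[OF that(1), of n] by simp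
    moreover have "w n * nat (a n) \<le> weight w a"
      unfolding weight_def using that(1) \<open>a n \<noteq> 0\<close>
      by (intro member_le_sum) (auto simp: finite_strings_def)
    ultimately show False using that(2) by linarith
  qed
  then have "{a \<in> finite_strings. val \<beta> a = v \<and> weight w a \<le> 0} \<subseteq> {\<lambda>_. 0}" by blast
  then show ?case by (rule finite_subset) simp
next
  case (Suc G)
  define S where "S = (\<lambda>v G. {a \<in> finite_strings. val \<beta> a = v \<and> weight w a \<le> G})"
  \<comment> \<open>If \<open>v > 0\<close>, a string of weight at most \<open>Suc G\<close> that starts at position \<open>N\<close> or later has value below \<open>v\<close>.\<close>
  obtain N where N: "\<And>n. n \<ge> N \<Longrightarrow> real (Suc G) / v < (\<Prod>i\<le>n. \<beta> i)"
    using unbounded by blast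
  have pos: "\<beta> n > 0" for n by (metis assms(1) less_trans zero_less_one)
  have prod_pos': "(\<Prod>i\<le>n. \<beta> i) > 0" for n by (rule prod_pos) (rule pos)
  have "S v (Suc G) \<subseteq> {\<lambda>_. 0} \<union>
    (\<Union>n<N. (\<lambda>b m. unit_string n m + b m) ` S (v - val \<beta> (unit_string n)) G)"
  proof
    fix a assume "a \<in> S v (Suc G)"
    then have a: "a \<in> finite_strings" "val \<beta> a = v" "weight w a \<le> Suc G" by (auto simp: S_def)
    show "a \<in> {\<lambda>_. 0} \<union>
      (\<Union>n<N. (\<lambda>b m. unit_string n m + b m) ` S (v - val \<beta> (unit_string n)) G)"
    proof (cases "a = (\<lambda>_. 0)")
      case False
      then have ex: "\<exists>n. a n \<noteq> 0" by auto
      define n where "n = (LEAST n. a n \<noteq> 0)"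
      have n: "a n \<noteq> 0" unfolding n_def using ex by (rule LeastI_ex)
      have below: "a m = 0" if "m < n" for m
        using not_less_Least[of m "\<lambda>n. a n \<noteq> 0"] that by (auto simp: n_def)
      have "a n \<ge> 1" using n finite_strings_nonneg[OF a(1), of n] by linarith
      have "0 < of_int (a n) / (\<Prod>i\<le>n. \<beta> i)" using \<open>a n \<ge> 1\<close> prod_pos' by simp
      also have "\<dots> \<le> v" using val_ge_digit[where \<beta> = \<beta> and n = n, OF a(1) pos] a(2) by simp
      finally have "v > 0" .
      have "v \<le> real (weight w a) / (\<Prod>i\<le>n. \<beta> i)"
        using val_le_weight[where w = w and \<beta> = \<beta> and n = n, OF a(1) assms(1,2) below] a(2) by simp
      also have "\<dots> \<le> real (Suc G) / (\<Prod>i\<le>n. \<beta> i)"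
        using a(3) prod_pos'[of n] by (intro divide_right_mono) simp_all
      finally have "(\<Prod>i\<le>n. \<beta> i) \<le> real (Suc G) / v"
        using \<open>v > 0\<close> prod_pos'[of n] by (simp add: field_simps)
      then have "n < N" using N[of n] by (meson linorder_not_le)
      define b where "b = (\<lambda>m. a m - unit_string n m)"
      have ab: "a = (\<lambda>m. unit_string n m + b m)" by (simp add: b_def)
      have b: "b \<in> finite_strings"
        by (rule finite_strings_smaller[OF a(1)])
          (use \<open>a n \<ge> 1\<close> finite_strings_nonneg[OF a(1)] in \<open>auto simp: b_def unit_string_def\<close>)
      have "val \<beta> a = val \<beta> (unit_string n) + val \<beta> b"
        by (subst ab) (rule val_add[OF unit_string_finite b])
      moreover have "weight w a = w n + weight w b"
        by (subst ab) (simp add: weight_add[OF unit_string_finite b] weight_unit_string)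
      ultimately have "b \<in> S (v - val \<beta> (unit_string n)) G"
        using a b assms(2)[of n] by (auto simp: S_def)
      then show ?thesis using \<open>n < N\<close> ab by blast
    qed simp
  qed
  moreover have "finite ({\<lambda>_. 0} \<union>
    (\<Union>n<N. (\<lambda>b m. unit_string n m + b m) ` S (v - val \<beta> (unit_string n)) G))"
    using Suc.IH by (simp add: S_def)
  ultimately have "finite (S v (Suc G))" by (rule finite_subset)
  then show ?case by (simp add: S_def)
qed

section \<open>Periodicity of the base\<close>

lemma shift_base_mult_period:
  assumes "alternate_base p \<beta>"
  shows "shift_base (l + j * p) \<beta> = shift_base l \<beta>"
proof (induction j)
  case (Suc j)
  have "\<beta> (n + p) = \<beta> n" for n using assms by (simp add: alternate_base_def)
  then have "shift_base (l + Suc j * p) \<beta> = shift_base (l + j * p) \<beta>"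
    unfolding shift_base_def fun_eq_iff by (metis add.assoc add.commute mult_Suc)
  then show ?case using Suc by simp
qed simp

text \<open>
  By periodicity the base takes finitely many values, so it is bounded below by its minimum over
  one period, a constant above 1.
\<close>

lemma alternate_base_prod_unbounded:
  assumes "alternate_base p \<beta>"
  shows "\<exists>N. \<forall>n\<ge>N. C < (\<Prod>i\<le>n. \<beta> i)"
proof -
  have p: "p \<ge> 1" and gt: "\<And>n. \<beta> n > 1" using assms by (auto simp: alternate_base_def)
  define c where "c = Min (\<beta> ` {..<p})"
  have ne: "\<beta> ` {..<p} \<noteq> {}" using p by (auto simp: lessThan_empty_iff)
  have c: "c > 1" using gt ne by (simp add: c_def)
  have le: "c \<le> \<beta> n" for n
  proof -
    have "shift_base (n mod p + n div p * p) \<beta> 0 = shift_base (n mod p) \<beta> 0"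
      by (simp only: shift_base_mult_period[OF assms])
    then have "\<beta> n = \<beta> (n mod p)" by (simp add: shift_base_def)
    then show ?thesis using p by (auto simp: c_def intro!: Min_le)
  qed
  obtain N where N: "C < c ^ N" using real_arch_pow[OF c] by blast
  have "C < (\<Prod>i\<le>n. \<beta> i)" if "n \<ge> N" for n
  proof -
    have "C < c ^ N" by (rule N)
    also have "\<dots> \<le> c ^ Suc n" using that c by (intro power_increasing) auto
    also have "\<dots> = (\<Prod>i\<le>n. c)" by simp
    also have "\<dots> \<le> (\<Prod>i\<le>n. \<beta> i)" using le c by (intro prod_mono) (auto intro: less_imp_le)
    finally show ?thesis .
  qed
  then show ?thesis by blast
qed

lemma val_prepend_period:
  assumes "alternate_base p \<beta>" and "a \<in> finite_strings"
  shows "(\<Prod>i<j * p. \<beta> i) * val \<beta> (prepend_zeros (j * p) a) = val \<beta> a"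
proof -
  have "\<beta> n > 0" for n using assms(1) by (metis alternate_base_def less_trans zero_less_one)
  then show ?thesis
    using val_prepend_zeros[OF assms(2), of \<beta> "j * p"] shift_base_mult_period[OF assms(1), of 0 j]
    by (simp add: shift_base_def)
qed

lemma weight_prepend_period:
  assumes "\<And>a. a \<in> finite_strings \<Longrightarrow> weight w (prepend_zeros p a) = weight w a"
    and "a \<in> finite_strings"
  shows "weight w (prepend_zeros (j * p) a) = weight w a"
proof (induction j)
  case 0
  then show ?case by (simp add: prepend_zeros_def)
next
  case (Suc j)
  then show ?case
    using assms(1)[OF finite_strings_prepend[OF assms(2), of "j * p"]]
    by (simp add: prepend_zeros_add)
qed

section \<open>Greedy expansions\<close>

lemma remainder_nonneg: "0 \<le> x \<Longrightarrow> 0 \<le> remainder \<beta> x n"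
  by (cases n) auto

lemma expansion_nonneg: "0 \<le> x \<Longrightarrow> (\<And>n. 0 < \<beta> n) \<Longrightarrow> 0 \<le> expansion \<beta> x n"
  using remainder_nonneg[of x \<beta> n] by (simp add: expansion_def less_imp_le)

lemma remainder_step: "remainder \<beta> x (Suc n) = \<beta> n * remainder \<beta> x n - of_int (expansion \<beta> x n)"
  by (simp add: expansion_def)

text \<open>
  When all tail values lie in \<open>{0..<1}\<close>, they obey the recursion of the remainders and each digit
  is forced to be the floor that the greedy algorithm takes.
\<close>

lemma expansion_val:
  assumes "a \<in> finite_strings" and "\<And>n. \<beta> n > 0"
    and "\<And>n. val (shift_base n \<beta>) (drop_digits n a) < 1"
  shows "expansion \<beta> (val \<beta> a) = a"
proof -
  let ?v = "\<lambda>n. val (shift_base n \<beta>) (drop_digits n a)"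
  have nonneg: "?v n \<ge> 0" for n
    using assms(2) by (intro val_nonneg finite_strings_drop assms(1)) (simp add: shift_base_def)
  have digit: "\<lfloor>\<beta> n * ?v n\<rfloor> = a n" for n
    using val_drop_digits_step[of a \<beta> n] assms nonneg[of "Suc n"] assms(3)[of "Suc n"]
    by (intro floor_unique) auto
  have "remainder \<beta> (val \<beta> a) n = ?v n" for n
  proof (induction n)
    case 0
    show ?case by (simp add: shift_base_def drop_digits_def)
  next
    case (Suc n)
    then show ?case using val_drop_digits_step[of a \<beta> n] assms digit[of n] by simp
  qed
  then show ?thesis using digit by (simp add: expansion_def)
qed

text \<open>
  The defect of a partial sum is the remainder divided by a product of the base.  Once the digits
  have ended the defect no longer changes, yet it tends to 0 because remainders stay below 1, so
  it vanishes.
\<close>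

lemma val_expansion_finite:
  assumes "expansion \<beta> x \<in> finite_strings" and "0 \<le> x" and "x < 1"
    and "\<And>n. \<beta> n > 1" and unbounded: "\<And>C. \<exists>N. \<forall>n\<ge>N. C < (\<Prod>i\<le>n. \<beta> i)"
  shows "val \<beta> (expansion \<beta> x) = x"
proof -
  obtain N where N: "\<And>m. m \<ge> N \<Longrightarrow> expansion \<beta> x m = 0"
    using assms(1) by (rule finite_string_bound) blast
  have pos: "(\<Prod>i<m. \<beta> i) > 0" for m
    by (rule prod_pos) (metis assms(4) less_trans zero_less_one)
  have partial: "x = (\<Sum>n<m. of_int (expansion \<beta> x n) / (\<Prod>i\<le>n. \<beta> i))
      + remainder \<beta> x m / (\<Prod>i<m. \<beta> i)" for m
  proof (induction m)
    case (Suc m)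
    have "remainder \<beta> x m / (\<Prod>i<m. \<beta> i)
        = (\<beta> m * remainder \<beta> x m) / (\<Prod>i<Suc m. \<beta> i)"
      using assms(4)[of m] by simp
    also have "\<dots> = of_int (expansion \<beta> x m) / (\<Prod>i\<le>m. \<beta> i)
        + remainder \<beta> x (Suc m) / (\<Prod>i<Suc m. \<beta> i)"
      by (simp add: remainder_step add_divide_distrib[symmetric] lessThan_Suc_atMost
          del: remainder.simps prod.lessThan_Suc)
    finally show ?case using Suc by simp
  qed simp
  let ?v = "val \<beta> (expansion \<beta> x)"
  have rem1: "0 \<le> remainder \<beta> x m" "remainder \<beta> x m < 1" for m
  proof -
    show "0 \<le> remainder \<beta> x m" using assms(2) by (rule remainder_nonneg)
    show "remainder \<beta> x m < 1" using assms(3) by (cases m) (auto, linarith)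
  qed
  have diff: "x - ?v = remainder \<beta> x m / (\<Prod>i<m. \<beta> i)" if "m \<ge> N" for m
    using partial[of m] val_eq_sum[of m "expansion \<beta> x" \<beta>] N that by simp
  show ?thesis
  proof (rule ccontr)
    assume "?v \<noteq> x"
    moreover have "x - ?v \<ge> 0" using diff[of N] rem1 pos[of N] by simp
    ultimately have d: "x - ?v > 0" by simp
    obtain M where M: "\<And>n. n \<ge> M \<Longrightarrow> 1 / (x - ?v) < (\<Prod>i\<le>n. \<beta> i)" using unbounded by blast
    define m where "m = max M N"
    have "1 / (x - ?v) < (\<Prod>i<Suc m. \<beta> i)" using M[of m] by (simp add: m_def lessThan_Suc_atMost)
    then have "1 < (x - ?v) * (\<Prod>i<Suc m. \<beta> i)" using d by (simp add: field_simps)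
    also have "\<dots> = remainder \<beta> x (Suc m)"
      using diff[of "Suc m"] pos[of "Suc m"] less_imp_neq[OF pos[of "Suc m"]]
      by (simp add: m_def field_simps del: remainder.simps prod.lessThan_Suc prod_zero_iff)
    finally show False using rem1(2)[of "Suc m"] by linarith
  qed
qed

text \<open>
  Both the remainders of 1 and the tail values satisfy the same recursion, differing only in the
  digit subtracted.  At the first position \<open>k\<close> where the digits differ the remainder wins: its
  digit is larger by at least 1, which outweighs the next tail value.  At the earlier positions
  the digits agree, so the inequality is carried back to position \<open>n\<close>, where the remainder is 1.
\<close>

lemma tail_val_less_one:
  assumes "a \<in> finite_strings" and "\<And>n. \<beta> n > 1"
    and tails: "\<And>m. m > n \<Longrightarrow> val (shift_base m \<beta>) (drop_digits m a) < 1"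
    and eq: "\<And>i. i < k \<Longrightarrow> a (i + n) = expansion_one \<beta> n i"
    and less: "a (k + n) < expansion_one \<beta> n k"
  shows "val (shift_base n \<beta>) (drop_digits n a) < 1"
proof -
  let ?v = "\<lambda>m. val (shift_base m \<beta>) (drop_digits m a)"
  let ?r = "remainder (shift_base n \<beta>) 1"
  have pos: "\<beta> m > 0" for m by (metis assms(2) less_trans zero_less_one)
  have step: "\<beta> (i + n) * (?r i - ?v (i + n))
      = ?r (Suc i) - ?v (Suc i + n) + of_int (expansion_one \<beta> n i - a (i + n))" for i
    using remainder_step[of "shift_base n \<beta>" 1 i] val_drop_digits_step[of a \<beta> "i + n"] assms(1) pos
    by (simp add: expansion_one_def right_diff_distrib shift_base_def del: remainder.simps)
  have "?r i > ?v (i + n)" if "i \<le> k" for i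
    using that
  proof (induction i rule: inc_induct)
    case base
    have "?r (Suc k) \<ge> 0" by (rule remainder_nonneg) simp
    moreover have "?v (Suc k + n) < 1" by (rule tails) simp
    moreover have "of_int (expansion_one \<beta> n k - a (k + n)) \<ge> (1::real)"
      using less by linarith
    ultimately have "\<beta> (k + n) * (?r k - ?v (k + n)) > 0" unfolding step by linarith
    then show ?case using pos[of "k + n"] by (simp add: zero_less_mult_iff)
  next
    case (step i)
    then have "\<beta> (i + n) * (?r i - ?v (i + n)) > 0"
      unfolding \<open>\<And>i. \<beta> (i + n) * (?r i - ?v (i + n)) = _ i\<close> using eq[of i] by simp
    then show ?case using pos[of "i + n"] by (simp add: zero_less_mult_iff)
  qed
  from this[of 0] show ?thesis by simp
qed

lemma tail_contains_forbidden:
  assumes "a \<in> finite_strings" and "\<And>n. \<beta> n > 1"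
    and ge: "val (shift_base n \<beta>) (drop_digits n a) \<ge> 1"
    and tails: "\<And>m. m > n \<Longrightarrow> val (shift_base m \<beta>) (drop_digits m a) < 1"
  shows "expansion_one \<beta> n = drop_digits n a \<or>
    (\<exists>k. \<forall>i. truncate_incr k (expansion_one \<beta> n) i \<le> drop_digits n a i)"
proof (cases "expansion_one \<beta> n = drop_digits n a")
  case False
  then have ex: "\<exists>k. a (k + n) \<noteq> expansion_one \<beta> n k" by (metis drop_digits_def ext)
  define k where "k = (LEAST k. a (k + n) \<noteq> expansion_one \<beta> n k)"
  have k: "a (k + n) \<noteq> expansion_one \<beta> n k" unfolding k_def using ex by (rule LeastI_ex)
  have eq: "a (i + n) = expansion_one \<beta> n i" if "i < k" for i
    using not_less_Least[of i "\<lambda>k. a (k + n) \<noteq> expansion_one \<beta> n k"] that by (auto simp: k_def)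
  have "\<not> a (k + n) < expansion_one \<beta> n k"
    using tail_val_less_one[OF assms(1,2) tails eq] ge by (meson linorder_not_le)
  then have "truncate_incr k (expansion_one \<beta> n) i \<le> drop_digits n a i" for i
    using k eq finite_strings_nonneg[OF assms(1)]
    by (auto simp: truncate_incr_def drop_digits_def)
  then show ?thesis by blast
qed simp

section \<open>Rewriting increases a non-greedy string\<close>

lemma less_fun_add:
  fixes b s t :: "nat \<Rightarrow> int"
  assumes "less_fun s t"
  shows "less_fun (\<lambda>n. b n + s n) (\<lambda>n. b n + t n)"
  using assms by (auto simp: less_fun_def)

lemma less_fun_prepend:
  assumes "less_fun s t"
  shows "less_fun (prepend_zeros m s) (prepend_zeros m t)"
proof -
  obtain k where "s k < t k" "\<And>k'. k' < k \<Longrightarrow> s k' = t k'" using assms by (auto simp: less_fun_def)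
  then show ?thesis
    unfolding less_fun_def by (intro exI[of _ "k + m"]) (auto simp: prepend_zeros_def)
qed

lemma less_fun_prepend_cancel:
  assumes "less_fun (prepend_zeros m s) (prepend_zeros m t)"
  shows "less_fun s t"
proof -
  obtain k where k: "prepend_zeros m s k < prepend_zeros m t k"
    and eq: "\<And>k'. k' < k \<Longrightarrow> prepend_zeros m s k' = prepend_zeros m t k'"
    using assms by (auto simp: less_fun_def)
  have "m \<le> k" using k by (auto simp: prepend_zeros_def split: if_splits)
  moreover have "s i = t i" if "i < k - m" for i
    using eq[of "i + m"] that by (simp add: prepend_zeros_def)
  ultimately show ?thesis
    unfolding less_fun_def using k by (intro exI[of _ "k - m"]) (auto simp: prepend_zeros_def)
qed

text \<open>
  A positive digit among the first \<open>p\<close> would contribute at least one unit of position \<open>p - 1\<close>,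
  which is the reciprocal of the product.
\<close>

lemma leading_zeros_of_small_val:
  assumes "c \<in> finite_strings" and "\<And>n. \<beta> n > 1" and small: "(\<Prod>i<p. \<beta> i) * val \<beta> c < 1"
  shows "c = prepend_zeros p (drop_digits p c)"
proof -
  have pos: "\<beta> m > 0" for m by (metis assms(2) less_trans zero_less_one)
  have "c n = 0" if "n < p" for n
  proof (rule ccontr)
    assume "c n \<noteq> 0"
    then have "1 \<le> c n" using finite_strings_nonneg[OF assms(1), of n] by linarith
    have P: "(\<Prod>i\<le>n. \<beta> i) > 0" by (rule prod_pos) (rule pos)
    have "(\<Prod>i\<le>n. \<beta> i) \<le> (\<Prod>i<p. \<beta> i)"
      using that by (intro prod_mono2) (auto intro: less_imp_le assms(2) pos)
    then have "1 \<le> (\<Prod>i<p. \<beta> i) * (1 / (\<Prod>i\<le>n. \<beta> i))" using P by simp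
    also have "\<dots> \<le> (\<Prod>i<p. \<beta> i) * (of_int (c n) / (\<Prod>i\<le>n. \<beta> i))"
      using \<open>1 \<le> c n\<close> P pos
      by (intro mult_left_mono divide_right_mono) (auto intro!: prod_nonneg intro: less_imp_le)
    also have "\<dots> \<le> (\<Prod>i<p. \<beta> i) * val \<beta> c"
      using pos by (intro mult_left_mono val_ge_digit[OF assms(1)]) (auto intro!: prod_nonneg intro: less_imp_le)
    finally show False using small by linarith
  qed
  then show ?thesis by (auto simp: prepend_zeros_def drop_digits_def fun_eq_iff)
qed

text \<open>
  The forbidden string \<open>s\<close> begins with \<open>p + l\<close> zeros and is moved \<open>j\<close> periods to the right to meet
  position \<open>p + l + j * p = p + n\<close> of \<open>A\<close>, which is \<open>a\<close> with one period of zeros in front.  These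
  extra zeros give the rewriting of \<open>s\<close> room to become larger to the left of \<open>n\<close>.  Moving by whole
  periods scales all values alike and leaves the weights unchanged.
\<close>

lemma rewrite_forbidden:
  assumes base: "alternate_base p \<beta>" and T: "is_rewriting p \<beta> T"
    and w: "\<And>a. a \<in> finite_strings \<Longrightarrow> weight w (prepend_zeros p a) = weight w a"
    and wT: "\<And>a. a \<in> forbidden_strings p \<beta> \<Longrightarrow> weight w (T a) \<le> weight w a"
    and a: "a \<in> finite_strings" and small: "val \<beta> a < 1"
    and n: "n = l + j * p"
    and u: "u \<in> finite_strings" and le: "\<And>i. u i \<le> drop_digits n a i"
    and forb: "prepend_zeros (p + l) u \<in> forbidden_strings p \<beta>"
  obtains b where "b \<in> finite_strings" "val \<beta> b = val \<beta> a" "weight w b \<le> weight w a" "less_fun a b"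
proof -
  have gt: "\<And>n. \<beta> n > 1" using base by (simp add: alternate_base_def)
  define s where "s = prepend_zeros (p + l) u"
  have s: "s \<in> finite_strings" unfolding s_def by (rule finite_strings_prepend[OF u])
  have Ts: "T s \<in> finite_strings" "val \<beta> (T s) = val \<beta> s" "less_fun s (T s)" "weight w (T s) \<le> weight w s"
    using T wT forb by (auto simp: is_rewriting_def s_def)
  define q where "q = prepend_zeros (j * p) s"
  define q' where "q' = prepend_zeros (j * p) (T s)"
  have fin: "q \<in> finite_strings" "q' \<in> finite_strings"
    by (simp_all add: q_def q'_def finite_strings_prepend s Ts)
  have "(\<Prod>i<j * p. \<beta> i) > 0" by (rule prod_pos) (metis gt less_trans zero_less_one)
  then have val_q: "val \<beta> q' = val \<beta> q"
    using val_prepend_period[OF base s, of j] val_prepend_period[OF base Ts(1), of j] Ts(2)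
    unfolding q_def q'_def by (metis less_irrefl mult_left_cancel)
  have weight_q: "weight w q' \<le> weight w q"
    using weight_prepend_period[of w p, OF w s] weight_prepend_period[of w p, OF w Ts(1)] Ts(4)
    by (simp add: q_def q'_def)
  define A where "A = prepend_zeros p a"
  have A: "A \<in> finite_strings" by (simp add: A_def finite_strings_prepend a)
  have q_alt: "q = prepend_zeros (p + n) u"
    unfolding q_def s_def prepend_zeros_add by (simp add: n ac_simps)
  have q_le: "q i \<le> A i" for i
  proof (cases "i < p + n")
    case True
    then show ?thesis using finite_strings_nonneg[OF A] by (simp add: q_alt prepend_zeros_def)
  next
    case False
    then show ?thesis using le[of "i - (p + n)"] by (simp add: q_alt A_def prepend_zeros_def drop_digits_def)
  qed
  define d where "d = (\<lambda>i. A i - q i)"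
  have d: "d \<in> finite_strings"
    by (rule finite_strings_smaller[OF A]) (use q_le finite_strings_nonneg[OF fin(1)] in \<open>auto simp: d_def\<close>)
  have A_eq: "A = (\<lambda>i. d i + q i)" by (simp add: d_def)
  define c where "c = (\<lambda>i. d i + q' i)"
  have c: "c \<in> finite_strings" unfolding c_def by (rule finite_strings_add[OF d fin(2)])
  have val_c: "val \<beta> c = val \<beta> A"
    unfolding A_eq c_def using val_q by (simp add: val_add d fin)
  have weight_c: "weight w c \<le> weight w A"
    unfolding A_eq c_def using weight_q by (simp add: weight_add d fin)
  have less_c: "less_fun A c"
    unfolding A_eq c_def q_def q'_def by (intro less_fun_add less_fun_prepend Ts(3))
  have val_A: "(\<Prod>i<p. \<beta> i) * val \<beta> A = val \<beta> a"
    using val_prepend_period[OF base a, of 1] by (simp add: A_def)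
  define b where "b = drop_digits p c"
  have cb: "c = prepend_zeros p b"
    unfolding b_def by (rule leading_zeros_of_small_val[where \<beta> = \<beta>, OF c gt]) (simp add: val_c val_A small)
  have b: "b \<in> finite_strings" unfolding b_def by (rule finite_strings_drop[OF c])
  have "val \<beta> b = val \<beta> a"
    using val_prepend_period[OF base b, of 1] val_c val_A by (simp add: cb)
  moreover have "weight w b \<le> weight w a"
    using w[OF b] w[OF a] weight_c by (simp add: cb A_def)
  moreover have "less_fun a b"
    using less_c unfolding A_def cb by (rule less_fun_prepend_cancel)
  ultimately show ?thesis using that b by blast
qed

text \<open>
  The last tail of value at least 1 is the right place to rewrite: all later tails are below 1, as
  the comparison with the expansion of 1 requires.  It exists because the tails of a finite string
  are eventually zero.  Periodicity of the base then reduces its position modulo \<open>p\<close>.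
\<close>

lemma non_greedy_improvable:
  assumes base: "alternate_base p \<beta>" and T: "is_rewriting p \<beta> T"
    and w: "\<And>a. a \<in> finite_strings \<Longrightarrow> weight w (prepend_zeros p a) = weight w a"
    and wT: "\<And>a. a \<in> forbidden_strings p \<beta> \<Longrightarrow> weight w (T a) \<le> weight w a"
    and a: "a \<in> finite_strings" and small: "val \<beta> a < 1"
    and not_greedy: "val (shift_base m \<beta>) (drop_digits m a) \<ge> 1"
  obtains b where "b \<in> finite_strings" "val \<beta> b = val \<beta> a" "weight w b \<le> weight w a" "less_fun a b"
proof -
  have p: "p \<ge> 1" and gt: "\<And>n. \<beta> n > 1" using base by (auto simp: alternate_base_def)
  have pos: "\<beta> m > 0" for m by (metis gt less_trans zero_less_one)
  let ?v = "\<lambda>m. val (shift_base m \<beta>) (drop_digits m a)"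
  obtain N where N: "\<And>i. i \<ge> N \<Longrightarrow> a i = 0" using a by (rule finite_string_bound) blast
  have bounded: "i \<le> N" if "?v i \<ge> 1" for i
  proof (rule ccontr)
    assume "\<not> i \<le> N"
    then have "?v i = 0"
      using val_eq_sum[of 0 "drop_digits i a" "shift_base i \<beta>"] N by (simp add: drop_digits_def)
    then show False using that by simp
  qed
  define n where "n = (GREATEST n. ?v n \<ge> 1)"
  have ge: "?v n \<ge> 1"
    unfolding n_def using not_greedy bounded by (rule GreatestI_nat)
  have tails: "?v i < 1" if "i > n" for i
    using Greatest_le_nat[of "\<lambda>n. ?v n \<ge> 1" i N] bounded that
    unfolding n_def by (metis leD linorder_not_le)
  define l where "l = n mod p"
  define j where "j = n div p"
  have n: "n = l + j * p" by (simp add: l_def j_def)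
  have l: "l < p" using p by (simp add: l_def)
  have exp_l: "expansion_one \<beta> n = expansion_one \<beta> l"
    by (simp add: expansion_one_def n shift_base_mult_period[OF base])
  have exp_nonneg: "0 \<le> expansion_one \<beta> n i" for i
    unfolding expansion_one_def by (rule expansion_nonneg) (simp_all add: shift_base_def pos)
  note rew = rewrite_forbidden[OF base T w wT a small n _ _ _ that]
  from tail_contains_forbidden[OF a gt ge tails] show ?thesis
  proof
    assume eq: "expansion_one \<beta> n = drop_digits n a"
    then have "expansion_one \<beta> n \<in> finite_strings" by (simp add: finite_strings_drop a)
    moreover from this have "prepend_zeros (p + l) (expansion_one \<beta> n) \<in> forbidden_strings p \<beta>"
      using l finite_strings_prepend unfolding forbidden_strings_def exp_l by blast
    ultimately show ?thesis by (intro rew[of "expansion_one \<beta> n"]) (simp_all add: eq)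
  next
    assume "\<exists>k. \<forall>i. truncate_incr k (expansion_one \<beta> n) i \<le> drop_digits n a i"
    then obtain k where k: "\<And>i. truncate_incr k (expansion_one \<beta> n) i \<le> drop_digits n a i" by blast
    have "truncate_incr k (expansion_one \<beta> n) \<in> finite_strings"
      using exp_nonneg by (intro finite_stringI[of _ "Suc k"]) (auto simp: truncate_incr_def)
    moreover have "prepend_zeros (p + l) (truncate_incr k (expansion_one \<beta> n)) \<in> forbidden_strings p \<beta>"
      using l unfolding forbidden_strings_def exp_l by blast
    ultimately show ?thesis using k by (intro rew[of "truncate_incr k (expansion_one \<beta> n)"]) simp_all
  qed
qed

section \<open>Property (PF)\<close>

text \<open>
  A lexicographically maximal string among those of the given value and bounded weight admits no
  improvement, so all its tails have value below 1 and it is greedy.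
\<close>

lemma val_finite_string_in_Fin:
  assumes base: "alternate_base p \<beta>" and "weight_property p \<beta>"
    and a: "a \<in> finite_strings" and small: "val \<beta> a < 1"
  shows "val \<beta> a \<in> Fin \<beta>"
proof -
  obtain T w where T: "is_rewriting p \<beta> T" and w0: "\<And>n. w n > 0"
    and w: "\<And>a. a \<in> finite_strings \<Longrightarrow> weight w (prepend_zeros p a) = weight w a"
    and wT: "\<And>a. a \<in> forbidden_strings p \<beta> \<Longrightarrow> weight w (T a) \<le> weight w a"
    using assms(2) unfolding weight_property_def by metis
  have gt: "\<And>n. \<beta> n > 1" using base by (simp add: alternate_base_def)
  have pos: "\<beta> m > 0" for m by (metis gt less_trans zero_less_one)
  define S where "S = {b \<in> finite_strings. val \<beta> b = val \<beta> a \<and> weight w b \<le> weight w a}"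
  have fin: "finite S"
    unfolding S_def by (rule finite_val_bounded_weight[OF gt w0 alternate_base_prod_unbounded[OF base]])
  have ne: "S \<noteq> {}" using a by (auto simp: S_def)
  have asym: "asymp_on S less_fun" by (rule asymp_onI) (rule less_fun_asym)
  have trans: "transp_on S less_fun" by (rule transp_onI) (rule less_fun_trans)
  obtain b where b: "b \<in> S" and max: "\<And>c. c \<in> S \<Longrightarrow> c \<noteq> b \<Longrightarrow> \<not> less_fun b c"
    using Finite_Set.bex_max_element[OF fin asym trans ne] by blast
  have b': "b \<in> finite_strings" "val \<beta> b = val \<beta> a" "weight w b \<le> weight w a"
    using b by (auto simp: S_def)
  have "val (shift_base m \<beta>) (drop_digits m b) < 1" for m
  proof (rule ccontr)
    assume "\<not> ?thesis"
    then have ge: "val (shift_base m \<beta>) (drop_digits m b) \<ge> 1" by simp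
    have "val \<beta> b < 1" using small b'(2) by simp
    then obtain c where "c \<in> finite_strings" "val \<beta> c = val \<beta> b" "weight w c \<le> weight w b" "less_fun b c"
      using non_greedy_improvable[OF base T w wT b'(1) _ ge] by blast
    then show False using max[of c] b' less_fun_irrefl[of b] by (auto simp: S_def)
  qed
  then have "expansion \<beta> (val \<beta> b) = b" using b'(1) pos by (intro expansion_val)
  then show ?thesis using b' small val_nonneg[OF a pos] by (simp add: Fin_def)
qed

theorem theorem5p6:
  fixes p :: nat and \<beta> :: "nat \<Rightarrow> real"
  assumes "alternate_base p \<beta>"
    and "weight_property p \<beta>"
  shows "property_PF \<beta>"
  unfolding property_PF_def
proof (intro ballI impI)
  fix x y assume x: "x \<in> Fin \<beta>" and y: "y \<in> Fin \<beta>" and xy: "x + y \<in> {0..<1}"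
  have gt: "\<And>n. \<beta> n > 1" using assms(1) by (simp add: alternate_base_def)
  have val: "val \<beta> (expansion \<beta> z) = z" if "z \<in> Fin \<beta>" for z
    using that val_expansion_finite[of \<beta> z, OF _ _ _ gt alternate_base_prod_unbounded[OF assms(1)]]
    by (simp add: Fin_def)
  let ?a = "\<lambda>n. expansion \<beta> x n + expansion \<beta> y n"
  have fin: "expansion \<beta> x \<in> finite_strings" "expansion \<beta> y \<in> finite_strings"
    using x y by (auto simp: Fin_def)
  have "val \<beta> ?a = x + y" by (simp add: val_add fin val x y)
  then show "x + y \<in> Fin \<beta>"
    using val_finite_string_in_Fin[OF assms finite_strings_add[OF fin]] xy by simp
qed

end
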